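(* Let $v\in\mathcal{G}^{N,\mathcal{A}}$ be a game and $\mathbf{u}$ a utility function. Then $\mathbf{u}\text{-core}(v)\neq\emptyset$ if and only if $v$ is $\mathbf{u}$-balanced.
   Context: $N$ is a nonempty finite set of players. $\mathcal{A}\subseteq 2^N$ is a family of feasible coalitions with $\emptyset,N\in\mathcal{A}$; $\mathcal{A}^*=\mathcal{A}\setminus\{\emptyset,N\}$, assumed nonempty. $\mathcal{G}^{N,\mathcal{A}}$ is the set of games, i.e. functions $v:\mathcal{A}\to\mathbb{R}$ with $v(\emptyset)=0$. For $x\in\mathbb{R}^N$, $x(S)=\sum_{i\in S}x_i$; the excess is $e(S,x)=v(S)-x(S)$. A utility function $\mathbf{u}$ is a family $(u_S)_{S\in\mathcal{A}^*}$ of strictly increasing continuous functions $u_S:\mathbb{R}\to\mathbb{R}$, all having the same range, denoted $R_{\mathbf{u}}$. The $\mathbf{u}$-core is $\mathbf{u}\text{-core}(v)=\{x\in\mathbb{R}^N: x(N)=v(N),\ u_S(e(S,x))\le 0\ \forall S\in\mathcal{A}^*\}$. A family $\mathcal{B}\subseteq\mathcal{A}\setminus\{\emptyset\}$ is balanced if there are weights $\lambda_S\ge 0$ ($S\in\mathcal{B}$), called a balancing weight system, with $\sum_{S\in\mathcal{B}}\lambda_S\chi_S=\chi_N$, where $\chi_T\in\mathbb{R}^N$ is the characteristic vector of $T$. The game $v$ is $\mathbf{u}$-balanced if either $R_{\mathbf{u}}\subseteq(-\infty,0)$, or $0\in R_{\mathbf{u}}$ and $$\max\Big(\lambda_N v(N)+\sum_{S\in\mathcal{B}\setminus\{N\}}\lambda_S\,(v(S)-u_S^{-1}(0))\Big)\le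 v(N),$$ the maximum being over all balanced families $\mathcal{B}\subseteq\mathcal{A}\setminus\{\emptyset\}$ and all their balancing weight systems $(\lambda_S)_{S\in\mathcal{B}}$ (with $\lambda_N=0$ if $N\notin\mathcal{B}$). *)

theory Defs
  imports "HOL-Analysis.Analysis" "HOL-Library.FuncSet"
begin

text \<open>
  The players are the elements of a finite type \<open>'n\<close>, so the player set \<open>N\<close> is \<open>UNIV\<close>
  (nonempty, as every type is) and \<open>\<real>\<^sup>N\<close> is \<open>real ^ 'n\<close>.  Functions on \<open>\<A>\<close> and families
  indexed by \<open>\<A>\<^sup>*\<close> are total functions that are undefined outside their index set.
\<close>

definition proper_coalitions :: "'n set set \<Rightarrow> 'n set set" where
  "proper_coalitions \<A> = \<A> - {{}, UNIV}"

definition games :: "'n set set \<Rightarrow> ('n set \<Rightarrow> real) set" where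
  "games \<A> = {v \<in> \<A> \<rightarrow>\<^sub>E UNIV. v {} = 0}"

definition payoff :: "real ^ 'n::finite \<Rightarrow> 'n set \<Rightarrow> real" where
  "payoff x S = (\<Sum>i\<in>S. x $ i)"

definition excess :: "('n set \<Rightarrow> real) \<Rightarrow> 'n::finite set \<Rightarrow> real ^ 'n \<Rightarrow> real" where
  "excess v S x = v S - payoff x S"

definition utility_functions :: "'n set set \<Rightarrow> ('n set \<Rightarrow> real \<Rightarrow> real) set" where
  "utility_functions \<A> =
     {u \<in> proper_coalitions \<A> \<rightarrow>\<^sub>E UNIV.
        (\<forall>S\<in>proper_coalitions \<A>. strict_mono (u S) \<and> continuous_on UNIV (u S)) \<and>
        (\<forall>S\<in>proper_coalitions \<A>. \<forall>T\<in>proper_coalitions \<A>. range (u S) = range (u T))}"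

text \<open>Well defined for a utility function as soon as \<open>\<A>\<^sup>*\<close> is nonempty.\<close>

definition utility_range :: "'n set set \<Rightarrow> ('n set \<Rightarrow> real \<Rightarrow> real) \<Rightarrow> real set" where
  "utility_range \<A> u = (THE R. \<forall>S\<in>proper_coalitions \<A>. range (u S) = R)"

definition u_core ::
  "'n::finite set set \<Rightarrow> ('n set \<Rightarrow> real \<Rightarrow> real) \<Rightarrow> ('n set \<Rightarrow> real) \<Rightarrow> (real ^ 'n) set" where
  "u_core \<A> u v =
     {x. payoff x UNIV = v UNIV \<and> (\<forall>S\<in>proper_coalitions \<A>. u S (excess v S x) \<le> 0)}"

definition char_vec :: "'n set \<Rightarrow> real ^ 'n::finite" where
  "char_vec T = (\<chi> i. indicator T i)"

definition balancing_weights :: "'n::finite set set \<Rightarrow> ('n set \<Rightarrow> real) \<Rightarrow> bool" where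
  "balancing_weights \<B> l \<longleftrightarrow>
     (\<forall>S\<in>\<B>. 0 \<le> l S) \<and> (\<Sum>S\<in>\<B>. l S *\<^sub>R char_vec S) = char_vec UNIV"

definition balanced_family :: "'n::finite set set \<Rightarrow> 'n set set \<Rightarrow> bool" where
  "balanced_family \<A> \<B> \<longleftrightarrow> \<B> \<subseteq> \<A> - {{}} \<and> (\<exists>l. balancing_weights \<B> l)"

text \<open>
  The numbers over which the maximum in the balancedness condition is taken; the
  conditional implements the convention \<open>\<lambda>\<^sub>N = 0\<close> for \<open>N \<notin> \<B>\<close>.
\<close>

definition balanced_values ::
  "'n::finite set set \<Rightarrow> ('n set \<Rightarrow> real \<Rightarrow> real) \<Rightarrow> ('n set \<Rightarrow> real) \<Rightarrow> real set" where
  "balanced_values \<A> u v =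
     {(if UNIV \<in> \<B> then l UNIV else 0) * v UNIV
        + (\<Sum>S\<in>\<B> - {UNIV}. l S * (v S - inv (u S) 0)) | \<B> l.
      balanced_family \<A> \<B> \<and> balancing_weights \<B> l}"

text \<open>
  The family of values is infinite in general, so \<open>Max\<close> does not apply: the maximum is
  an element of the set that bounds the set from above.
\<close>

definition is_maximum :: "real set \<Rightarrow> real \<Rightarrow> bool" where
  "is_maximum X m \<longleftrightarrow> m \<in> X \<and> (\<forall>y\<in>X. y \<le> m)"

definition u_balanced ::
  "'n::finite set set \<Rightarrow> ('n set \<Rightarrow> real \<Rightarrow> real) \<Rightarrow> ('n set \<Rightarrow> real) \<Rightarrow> bool" where
  "u_balanced \<A> u v \<longleftrightarrow>
     utility_range \<A> u \<subseteq> {..<0} \<or>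
     0 \<in> utility_range \<A> u \<and>
       (\<exists>m. is_maximum (balanced_values \<A> u v) m \<and> m \<le> v UNIV)"

end

theory Submission
  imports Defs
begin

text \<open>
  If \<open>0\<close> is not in the common range of the utilities, then by the intermediate value theorem all of
  them are negative or all of them are positive.  In the first case the core constraints are
  vacuous, in the second they cannot be met.

  If \<open>0\<close> is in the common range, then by monotonicity \<open>u\<^sub>S(e(S,x)) \<le> 0\<close> says that
  \<open>x(S) \<ge> v(S) - u\<^sub>S\<^sup>-\<^sup>1(0)\<close>.  The \<open>u\<close>-core is therefore the classical core of the
  game \<open>w\<close> with \<open>w(S) = v(S) - u\<^sub>S\<^sup>-\<^sup>1(0)\<close> for proper coalitions and \<open>w(N) = v(N)\<close>
  (lemma \<open>u_core_eq_core_threshold_game\<close>), and the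
  numbers in the balancedness condition are the values \<open>\<Sum>\<lambda>\<^sub>S w(S)\<close> of the balancing weight
  systems on the family of all nonempty feasible coalitions
  (lemma \<open>balanced_values_eq_threshold_game_values\<close>).  The claim is then the
  Bondareva-Shapley theorem for \<open>w\<close> (lemma \<open>bondareva_shapley\<close>), which is linear programming
  duality and is obtained here from Farkas' lemma in \<open>\<real>\<^sup>N \<times> \<real>\<close>.  The maximum is attained
  whenever the values are bounded by \<open>v(N)\<close>, because the grand coalition with weight \<open>1\<close> has the
  value \<open>v(N)\<close>.
\<close>

section \<open>Farkas' lemma\<close>

lemma convex_cone_hull_image_subset:
  assumes "finite I"
  shows "convex_cone hull (g ` I) \<subseteq> {\<Sum>i\<in>I. c i *\<^sub>R g i | c. \<forall>i\<in>I. 0 \<le> (c i :: real)}"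
    (is "_ \<subseteq> ?C")
proof (rule hull_minimal)
  show "g ` I \<subseteq> ?C"
  proof
    fix y assume "y \<in> g ` I"
    then obtain j where j: "j \<in> I" "y = g j" by blast
    have "(\<Sum>i\<in>I. (if i = j then 1 else 0) *\<^sub>R g i) = (\<Sum>i\<in>I. if i = j then g i else 0)"
      by (intro sum.cong) auto
    also have "\<dots> = y" using assms j by simp
    finally show "y \<in> ?C"
      by (intro CollectI exI[of _ "\<lambda>i. if i = j then 1 else 0"]) auto
  qed
  have "0 \<in> ?C"
    by (intro CollectI exI[of _ "\<lambda>_. 0"]) auto
  moreover have "x + y \<in> ?C" if "x \<in> ?C" "y \<in> ?C" for x y
  proof -
    from that obtain c d where
      "\<forall>i\<in>I. 0 \<le> c i" "x = (\<Sum>i\<in>I. c i *\<^sub>R g i)" "\<forall>i\<in>I. 0 \<le> d i" "y = (\<Sum>i\<in>I. d i *\<^sub>R g i)"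
      by blast
    then show ?thesis
      by (intro CollectI exI[of _ "\<lambda>i. c i + d i"]) (auto simp: scaleR_add_left sum.distrib)
  qed
  moreover have "a *\<^sub>R x \<in> ?C" if "x \<in> ?C" "0 \<le> a" for a x
  proof -
    from that obtain c where "\<forall>i\<in>I. 0 \<le> c i" "x = (\<Sum>i\<in>I. c i *\<^sub>R g i)"
      by blast
    then show ?thesis using \<open>0 \<le> a\<close>
      by (intro CollectI exI[of _ "\<lambda>i. a * c i"]) (auto simp: scaleR_sum_right)
  qed
  ultimately show "convex_cone ?C"
    unfolding convex_cone_iff by blast
qed

text \<open>
  A finitely generated cone is closed, so a point outside it is strictly separated from it by an
  affine hyperplane; since the cone is invariant under scaling, the hyperplane can be moved to the
  origin.
\<close>

lemma farkas_lemma: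
  fixes g :: "'i \<Rightarrow> 'a::euclidean_space"
  assumes "finite I"
    and dual: "\<And>y. (\<forall>i\<in>I. 0 \<le> y \<bullet> g i) \<Longrightarrow> 0 \<le> y \<bullet> z"
  shows "\<exists>c. (\<forall>i\<in>I. 0 \<le> c i) \<and> z = (\<Sum>i\<in>I. c i *\<^sub>R g i)"
proof -
  let ?K = "convex_cone hull (g ` I)"
  have "z \<in> ?K"
  proof (rule ccontr)
    assume "z \<notin> ?K"
    then obtain a b where az: "a \<bullet> z < b" and aK: "\<And>x. x \<in> ?K \<Longrightarrow> b < a \<bullet> x"
      using separating_hyperplane_closed_point[of ?K z] convex_convex_cone_hull
        closed_convex_cone_hull[of "g ` I"] \<open>finite I\<close> by blast
    have "b < 0"
      using aK[OF convex_cone_hull_contains_0] by simp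
    have "0 \<le> a \<bullet> g i" if "i \<in> I" for i
    proof (rule ccontr)
      assume neg: "\<not> 0 \<le> a \<bullet> g i"
      \<comment> \<open>The multiple of the generator on which \<open>a\<close> takes the forbidden value \<open>b\<close>.\<close>
      have "(b / (a \<bullet> g i)) *\<^sub>R g i \<in> ?K"
        using neg \<open>b < 0\<close> that
        by (intro convex_cone_hull_mul hull_inc) (auto intro: divide_nonpos_nonpos)
      from aK[OF this] show False using neg by simp
    qed
    then have "0 \<le> a \<bullet> z" by (intro dual) blast
    then show False using az \<open>b < 0\<close> by simp
  qed
  then show ?thesis
    using convex_cone_hull_image_subset[OF \<open>finite I\<close>, of g] by blast
qed

section \<open>The Bondareva-Shapley theorem\<close>

definition core :: "'n::finite set set \<Rightarrow> ('n set \<Rightarrow> real) \<Rightarrow> (real ^ 'n) set" where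
  "core \<F> w = {x. payoff x UNIV = w UNIV \<and> (\<forall>S\<in>\<F>. w S \<le> payoff x S)}"

lemma inner_char_vec: "x \<bullet> char_vec S = payoff x S"
proof -
  have "x \<bullet> char_vec S = (\<Sum>i\<in>UNIV. if i \<in> S then x $ i else 0)"
    unfolding inner_vec_def char_vec_def by (intro sum.cong) (auto simp: indicator_def)
  also have "\<dots> = payoff x S"
    unfolding payoff_def by (simp add: sum.If_cases)
  finally show ?thesis .
qed

lemma value_le_of_core:
  assumes "x \<in> core \<F> w" and "balancing_weights \<F> l"
  shows "(\<Sum>S\<in>\<F>. l S * w S) \<le> w UNIV"
proof -
  have "(\<Sum>S\<in>\<F>. l S * w S) \<le> (\<Sum>S\<in>\<F>. l S * payoff x S)"
    using assms by (intro sum_mono mult_left_mono) (auto simp: core_def balancing_weights_def)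
  also have "\<dots> = x \<bullet> (\<Sum>S\<in>\<F>. l S *\<^sub>R char_vec S)"
    by (simp add: inner_sum_right inner_char_vec)
  also have "\<dots> = w UNIV"
    using assms by (simp add: balancing_weights_def inner_char_vec core_def)
  finally show ?thesis .
qed

text \<open>
  The core is the solution set of \<open>x(S) - w(S) \<ge> 0\<close> for \<open>S \<in> \<F>\<close> and \<open>w(N) - x(N) \<ge> 0\<close>.
  After homogenisation these constraints are the vectors \<open>(\<chi>\<^sub>S, -w(S))\<close> and \<open>(-\<chi>\<^sub>N, w(N))\<close>, and
  the core is empty exactly if they force the last coordinate of their solutions to be nonpositive,
  that is, if \<open>(0,-1)\<close> is a nonnegative combination of them.  The coefficients of such a
  combination, normalised, are balancing weights whose value exceeds \<open>w(N)\<close>.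
\<close>

lemma bondareva_shapley:
  fixes \<F> :: "'n::finite set set"
  assumes "UNIV \<in> \<F>"
  shows "core \<F> w \<noteq> {} \<longleftrightarrow>
    (\<forall>l. balancing_weights \<F> l \<longrightarrow> (\<Sum>S\<in>\<F>. l S * w S) \<le> w UNIV)"
proof
  assume "core \<F> w \<noteq> {}"
  then show "\<forall>l. balancing_weights \<F> l \<longrightarrow> (\<Sum>S\<in>\<F>. l S * w S) \<le> w UNIV"
    using value_le_of_core by blast
next
  assume bound: "\<forall>l. balancing_weights \<F> l \<longrightarrow> (\<Sum>S\<in>\<F>. l S * w S) \<le> w UNIV"
  show "core \<F> w \<noteq> {}"
  proof
    assume empty: "core \<F> w = {}"
    \<comment> \<open>The index \<open>None\<close> stands for the constraint \<open>x(N) \<le> w(N)\<close>.\<close>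
    define g :: "'n set option \<Rightarrow> (real ^ 'n) \<times> real" where
      "g = case_option (- char_vec UNIV, w UNIV) (\<lambda>S. (char_vec S, - w S))"
    let ?I = "insert None (Some ` \<F>)"
    have "0 \<le> y \<bullet> (0, -1)" if y: "\<forall>i\<in>?I. 0 \<le> y \<bullet> g i" for y
    proof (rule ccontr)
      obtain z t where yzt: "y = (z, t)" by (cases y)
      assume "\<not> 0 \<le> y \<bullet> (0, -1)"
      then have "0 < t" by (simp add: yzt)
      have scaled: "payoff (z /\<^sub>R t) S = payoff z S / t" for S
        by (simp add: payoff_def sum_distrib_left divide_inverse_commute)
      have "t * w S \<le> payoff z S" if "S \<in> \<F>" for S
        using y that by (auto simp: g_def yzt inner_char_vec)
      moreover have "payoff z UNIV \<le> t * w UNIV"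
        using y by (auto simp: g_def yzt inner_char_vec)
      ultimately have "z /\<^sub>R t \<in> core \<F> w"
        using \<open>0 < t\<close> \<open>UNIV \<in> \<F>\<close> unfolding core_def mem_Collect_eq scaled
        by (auto simp: field_simps intro: antisym)
      then show False using empty by blast
    qed
    then obtain c where c: "\<forall>i\<in>?I. 0 \<le> c i" and comb: "(0, -1) = (\<Sum>i\<in>?I. c i *\<^sub>R g i)"
      using farkas_lemma[of ?I g "(0, -1)"] by auto
    have "(\<Sum>i\<in>?I. c i *\<^sub>R g i) = c None *\<^sub>R g None + (\<Sum>S\<in>\<F>. c (Some S) *\<^sub>R g (Some S))"
      by (subst sum.insert) (auto simp: sum.reindex)
    then have "(0, -1) =
        c None *\<^sub>R (- char_vec UNIV, w UNIV)
          + (\<Sum>S\<in>\<F>. c (Some S) *\<^sub>R (char_vec S :: real ^ 'n, - w S))"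
      using comb by (simp add: g_def)
    then have vecs: "(\<Sum>S\<in>\<F>. c (Some S) *\<^sub>R char_vec S :: real ^ 'n) = c None *\<^sub>R char_vec UNIV"
      and vals: "(\<Sum>S\<in>\<F>. c (Some S) * w S) = c None * w UNIV + 1"
      by (auto simp: prod_eq_iff fst_sum snd_sum sum_negf)
    \<comment> \<open>One more unit of weight on \<open>N\<close> makes the normalising factor positive.\<close>
    define l where "l S = (c (Some S) + (if S = UNIV then 1 else 0)) / (c None + 1)" for S
    have pos: "0 < c None + 1" using c by (simp add: add_nonneg_pos)
    have extra: "(\<Sum>S\<in>\<F>. (if S = UNIV then 1 else 0) *\<^sub>R f S) = f UNIV"
      for f :: "'n set \<Rightarrow> 'b::real_vector"
      using \<open>UNIV \<in> \<F>\<close> by (simp add: if_distrib[of "\<lambda>r. r *\<^sub>R _"] cong: if_cong)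
    have total: "(\<Sum>S\<in>\<F>. l S *\<^sub>R f S) =
        ((\<Sum>S\<in>\<F>. c (Some S) *\<^sub>R f S) + f UNIV) /\<^sub>R (c None + 1)"
      for f :: "'n set \<Rightarrow> 'b::real_vector"
    proof -
      have "(\<Sum>S\<in>\<F>. l S *\<^sub>R f S) =
          (\<Sum>S\<in>\<F>. c (Some S) *\<^sub>R f S + (if S = UNIV then 1 else 0) *\<^sub>R f S) /\<^sub>R (c None + 1)"
        unfolding scaleR_sum_right
        by (intro sum.cong refl)
           (simp only: l_def divide_inverse_commute scaleR_scaleR[symmetric] scaleR_add_left)
      then show ?thesis by (simp only: sum.distrib extra)
    qed
    have "(\<Sum>S\<in>\<F>. l S *\<^sub>R char_vec S) =
        (c None *\<^sub>R char_vec UNIV + char_vec UNIV :: real ^ 'n) /\<^sub>R (c None + 1)"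
      by (simp only: total vecs)
    also have "\<dots> = ((c None + 1) *\<^sub>R char_vec UNIV) /\<^sub>R (c None + 1)"
      by (simp only: scaleR_add_left scaleR_one)
    also have "\<dots> = char_vec UNIV" using pos by simp
    finally have "balancing_weights \<F> l"
      using c pos by (auto simp: balancing_weights_def l_def)
    then have "(\<Sum>S\<in>\<F>. l S * w S) \<le> w UNIV" using bound by blast
    moreover have "(\<Sum>S\<in>\<F>. l S * w S) = (c None * w UNIV + 1 + w UNIV) / (c None + 1)"
      using total[of w] vals by (simp add: divide_inverse mult.commute)
    ultimately show False using pos by (simp add: field_simps)
  qed
qed

section \<open>Reduction to the threshold game\<close>

definition threshold_game ::
  "('n set \<Rightarrow> real \<Rightarrow> real) \<Rightarrow> ('n set \<Rightarrow> real) \<Rightarrow> 'n set \<Rightarrow> real" where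
  "threshold_game u v S = (if S = UNIV then v UNIV else v S - inv (u S) 0)"

lemma range_eq_utility_range:
  assumes "u \<in> utility_functions \<A>" and "S \<in> proper_coalitions \<A>"
  shows "range (u S) = utility_range \<A> u"
proof -
  have "\<forall>T\<in>proper_coalitions \<A>. range (u T) = range (u S)"
    using assms unfolding utility_functions_def by blast
  then have "utility_range \<A> u = range (u S)"
    unfolding utility_range_def using assms(2) by (intro the_equality) blast+
  then show ?thesis ..
qed

lemma utility_nonpos_iff:
  assumes "u \<in> utility_functions \<A>" and "S \<in> proper_coalitions \<A>"
    and "0 \<in> utility_range \<A> u"
  shows "u S e \<le> 0 \<longleftrightarrow> e \<le> inv (u S) 0"
proof -
  have "strict_mono (u S)"
    using assms(1,2) unfolding utility_functions_def by blast
  then have "u S e \<le> u S (inv (u S) 0) \<longleftrightarrow> e \<le> inv (u S) 0"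
    by (rule strict_mono_less_eq)
  moreover have "0 \<in> range (u S)"
    unfolding range_eq_utility_range[OF assms(1,2)] by (rule assms(3))
  then have "u S (inv (u S) 0) = 0"
    by (rule f_inv_into_f)
  ultimately show ?thesis by metis
qed

lemma u_core_eq_core_threshold_game:
  assumes "u \<in> utility_functions \<A>" and "0 \<in> utility_range \<A> u" and "UNIV \<in> \<A>"
  shows "u_core \<A> u v = core (\<A> - {{}}) (threshold_game u v)"
proof -
  have family: "\<A> - {{}} = insert UNIV (proper_coalitions \<A>)"
    using assms(3) unfolding proper_coalitions_def by blast
  have "u S (excess v S x) \<le> 0 \<longleftrightarrow> threshold_game u v S \<le> payoff x S"
    if "S \<in> proper_coalitions \<A>" for S x
  proof -
    have "threshold_game u v S = v S - inv (u S) 0"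
      using that by (simp add: threshold_game_def proper_coalitions_def)
    then show ?thesis
      unfolding utility_nonpos_iff[OF assms(1) that assms(2)] excess_def by linarith
  qed
  then show ?thesis
    unfolding u_core_def core_def family by (auto simp: threshold_game_def[of u v UNIV])
qed

text \<open>Padding a weight system with zeros shows that the full family already realises every value.\<close>

lemma balanced_values_eq_threshold_game_values:
  "balanced_values \<A> u v =
    {\<Sum>S\<in>\<A> - {{}}. l S * threshold_game u v S | l. balancing_weights (\<A> - {{}}) l}"
    (is "_ = ?V")
proof -
  let ?w = "threshold_game u v"
  have value_eq: "(if UNIV \<in> \<B> then l UNIV else 0) * v UNIV
      + (\<Sum>S\<in>\<B> - {UNIV}. l S * (v S - inv (u S) 0)) = (\<Sum>S\<in>\<B>. l S * ?w S)" for \<B> l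
  proof -
    have rest: "(\<Sum>S\<in>\<B> - {UNIV}. l S * (v S - inv (u S) 0)) = (\<Sum>S\<in>\<B> - {UNIV}. l S * ?w S)"
      by (intro sum.cong) (auto simp: threshold_game_def)
    show ?thesis
    proof (cases "UNIV \<in> \<B>")
      case True
      then have "(\<Sum>S\<in>\<B>. l S * ?w S) = l UNIV * ?w UNIV + (\<Sum>S\<in>\<B> - {UNIV}. l S * ?w S)"
        by (intro sum.remove) auto
      with rest True show ?thesis by (simp add: threshold_game_def)
    next
      case False
      with rest show ?thesis by simp
    qed
  qed
  show ?thesis
  proof
    show "balanced_values \<A> u v \<subseteq> ?V"
    proof
      fix y assume "y \<in> balanced_values \<A> u v"
      then obtain \<B> l where y: "y = (\<Sum>S\<in>\<B>. l S * ?w S)"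
        and sub: "\<B> \<subseteq> \<A> - {{}}" and l: "balancing_weights \<B> l"
        unfolding balanced_values_def value_eq balanced_family_def by blast
      define l' where "l' S = (if S \<in> \<B> then l S else 0)" for S
      have "y = (\<Sum>S\<in>\<A> - {{}}. l' S * ?w S)"
        unfolding y using sub by (intro sum.mono_neutral_cong_left) (auto simp: l'_def)
      moreover have "(\<Sum>S\<in>\<B>. l S *\<^sub>R char_vec S) = (\<Sum>S\<in>\<A> - {{}}. l' S *\<^sub>R char_vec S)"
        using sub by (intro sum.mono_neutral_cong_left) (auto simp: l'_def)
      then have "balancing_weights (\<A> - {{}}) l'"
        using l by (auto simp: balancing_weights_def l'_def)
      ultimately show "y \<in> ?V" by blast
    qed
    show "?V \<subseteq> balanced_values \<A> u v"
      unfolding balanced_values_def value_eq balanced_family_def by blast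
  qed
qed

lemma grand_coalition_value_in_balanced_values:
  assumes "UNIV \<in> \<A>"
  shows "v UNIV \<in> balanced_values \<A> u v"
proof -
  have "balancing_weights {UNIV} (\<lambda>_. 1)"
    by (simp add: balancing_weights_def)
  then show ?thesis
    using assms unfolding balanced_values_def balanced_family_def
    by (intro CollectI exI[of _ "{UNIV}"] exI[of _ "\<lambda>_. 1"]) auto
qed

lemma u_core_nonempty_iff_balanced_values_le:
  assumes "u \<in> utility_functions \<A>" and "0 \<in> utility_range \<A> u" and "UNIV \<in> \<A>"
  shows "u_core \<A> u v \<noteq> {} \<longleftrightarrow> (\<forall>y\<in>balanced_values \<A> u v. y \<le> v UNIV)"
proof -
  have "u_core \<A> u v \<noteq> {} \<longleftrightarrow>
      (\<forall>l. balancing_weights (\<A> - {{}}) l \<longrightarrow>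
        (\<Sum>S\<in>\<A> - {{}}. l S * threshold_game u v S) \<le> threshold_game u v UNIV)"
    unfolding u_core_eq_core_threshold_game[OF assms]
    by (rule bondareva_shapley) (use assms in auto)
  then show ?thesis
    unfolding balanced_values_eq_threshold_game_values
    by (auto simp: threshold_game_def[of u v UNIV])
qed

lemma utility_range_neg_or_pos:
  assumes "u \<in> utility_functions \<A>" and "proper_coalitions \<A> \<noteq> {}"
    and "0 \<notin> utility_range \<A> u"
  shows "utility_range \<A> u \<subseteq> {..<0} \<or> utility_range \<A> u \<subseteq> {0<..}"
proof (rule ccontr)
  assume not: "\<not> ?thesis"
  obtain S where S: "S \<in> proper_coalitions \<A>" using assms(2) by blast
  have "continuous_on UNIV (u S)"
    using assms(1) S unfolding utility_functions_def by blast
  then have "connected (utility_range \<A> u)"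
    unfolding range_eq_utility_range[OF assms(1) S, symmetric]
    by (intro connected_continuous_image) auto
  moreover obtain p q where "p \<in> utility_range \<A> u" "0 \<le> p" "q \<in> utility_range \<A> u" "q \<le> 0"
    using not by (auto simp: subset_iff not_less)
  ultimately have "0 \<in> utility_range \<A> u"
    using connectedD_interval by blast
  then show False using assms(3) by blast
qed

theorem theorem6:
  fixes \<A> :: "'n::finite set set"
    and v :: "'n set \<Rightarrow> real"
    and u :: "'n set \<Rightarrow> real \<Rightarrow> real"
  assumes "{} \<in> \<A>" and "UNIV \<in> \<A>" and "proper_coalitions \<A> \<noteq> {}"
    and "v \<in> games \<A>"
    and "u \<in> utility_functions \<A>"
  shows "u_core \<A> u v \<noteq> {} \<longleftrightarrow> u_balanced \<A> u v"
proof -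
  obtain T where T: "T \<in> proper_coalitions \<A>" using assms(3) by blast
  have range_mem: "u S e \<in> utility_range \<A> u" if "S \<in> proper_coalitions \<A>" for S e
    using range_eq_utility_range[OF assms(5) that] by blast
  show ?thesis
  proof (cases "0 \<in> utility_range \<A> u")
    case True
    have "(\<exists>m. is_maximum (balanced_values \<A> u v) m \<and> m \<le> v UNIV) \<longleftrightarrow>
        (\<forall>y\<in>balanced_values \<A> u v. y \<le> v UNIV)"
      using grand_coalition_value_in_balanced_values[OF assms(2), of v u]
      unfolding is_maximum_def by (meson order.trans order.refl)
    moreover have "\<not> utility_range \<A> u \<subseteq> {..<0}" using True by auto
    ultimately show ?thesis
      using u_core_nonempty_iff_balanced_values_le[OF assms(5) True assms(2), of v] True
      unfolding u_balanced_def by simp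
  next
    case False
    with utility_range_neg_or_pos[OF assms(5,3)]
    consider "utility_range \<A> u \<subseteq> {..<0}" | "utility_range \<A> u \<subseteq> {0<..}" by blast
    then show ?thesis
    proof cases
      case 1
      \<comment> \<open>Any efficient payoff vector will do; here one player receives everything.\<close>
      define x :: "real ^ 'n" where "x = axis undefined (v UNIV)"
      have "payoff x UNIV = v UNIV"
        by (simp add: payoff_def x_def axis_def)
      moreover have "u S (excess v S x) \<le> 0" if "S \<in> proper_coalitions \<A>" for S
        using 1 range_mem[OF that, of "excess v S x"] by (auto simp: less_imp_le)
      ultimately have "x \<in> u_core \<A> u v" by (simp add: u_core_def)
      with 1 show ?thesis by (auto simp: u_balanced_def)
    next
      case 2
      have "0 < u T e" for e
        using 2 range_mem[OF T, of e] by auto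
      then have "u_core \<A> u v = {}"
        using T by (auto simp: u_core_def simp flip: not_less)
      moreover have "\<not> utility_range \<A> u \<subseteq> {..<0}"
        using 2 range_mem[OF T, of 0] by force
      ultimately show ?thesis using False by (simp add: u_balanced_def)
    qed
  qed
qed

end
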